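(* Let $A\in\mathbb{R}^{n\times d}$ with $\lambda_{\min}>0$, let $b\in\mathbb{R}^n$, and let the sampling probabilities satisfy $\eta p_j\ge\|a_j\|^2/\|A\|_F^2$ for $j=1,\dots,n$, for some $\eta\ge1$. Fix parameters $\alpha$ and $\beta\ge 0$ satisfying $$\frac{(1-\sqrt\beta)^2}{\lambda_{\min}}<\alpha<\frac{(1+\sqrt\beta)^2}{\lambda_{\max}}.$$ For any $k^*>1$ choose a batch size $$B\ge 16\,\mathrm{e}\,\eta\log(2d)\max\left\{\frac{\|A\|_F^2\|A\|^2\alpha^2M(\alpha,\beta)^2k^*}{\beta\log(k^* )},\ \left(\frac{2\|A\|_F^4\alpha^2M(\alpha,\beta)^2k^*}{\beta\log(k^* )}\right)^{1/2}\right\}.$$ Then, for all integers $k>0$, assuming that the minimizer $x^*$ of $f(x)=\frac12\|Ax-b\|^2$ satisfies $Ax^*=b$, the Minibatch-HBM iterates with constant parameters $\alpha,\beta$ and batch size $B$ satisfy $$\mathbb{E}\big[\|x_k-x^*\|\big]\le\sqrt2\,M(\alpha,\beta)\max\{d,(k^* )^{k/k^*}\}\,(\sqrt\beta)^k\,\|x_0-x^*\|.$$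
   Context: $\|\cdot\|$ is the Euclidean norm of vectors and the operator norm of matrices, $\|\cdot\|_F$ the Frobenius norm; $\log$ is the natural logarithm and $\mathrm{e}=2.718\ldots$. $a_j^{\mathsf T}$ denotes the $j$th row of $A$ and $b_j$ the $j$th entry of $b$. $\lambda_1,\dots,\lambda_d$ are the eigenvalues of $A^{\mathsf T}A$, with largest $\lambda_{\max}$ and smallest $\lambda_{\min}$ (so $\lambda_{\min}>0$ means $f$ is strongly convex). Sampling: $p_1,\dots,p_n>0$ with $\sum_jp_j=1$. For each $k\ge1$, $S_k$ is a list of $B$ indices drawn independently with replacement from $\{1,\dots,n\}$, where each draw equals $j$ with probability $p_j$; the lists $S_1,S_2,\dots$ are independent. The minibatch stochastic gradient is $$\nabla f_{S_k}(x)=\frac1B\sum_{j\in S_k}\frac1{p_j}a_j(a_j^{\mathsf T}x-b_j).$$ Minibatch-HBM (minibatch heavy ball momentum): given a deterministic $x_0$, set $x_1=x_0$ and for $k\ge1$ $$x_{k+1}=x_k-\alpha\nabla f_{S_k}(x_k)+\beta(x_k-x_{k-1}).$$ The quantity $M(\alpha,\beta)$: let $$T=\begin{bmatrix}(1+\beta)I-\alpha A^{\mathsf T}A&-\beta I\\ I&0\end{bmatrix}\in\mathbb{R}^{2d\times2d}.$$ There is an orthogonal matrix $U$ such that $U^{-1}TU$ is block diagonal with $2\times2$ blocks $T_j=\begin{bmatrix}1+\beta-\alpha\lambda_j&-\beta\\1&0\end{bmatrix}$, $j=1,\dots,d$. Under the stated condition on $\alpha,\beta$, each $T_j$ has two distinct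 non-real conjugate eigenvalues $z_j^{\pm}=\frac12\big(1+\beta-\alpha\lambda_j\pm\sqrt{(1+\beta-\alpha\lambda_j)^2-4\beta}\big)$, and $T_j=C_jD_jC_j^{-1}$ with $C_j=\begin{bmatrix}z_j^+&z_j^-\\1&1\end{bmatrix}$ and $D_j=\mathrm{diag}(z_j^+,z_j^-)$. Let $C$ be the block diagonal matrix with blocks $C_1,\dots,C_d$, so that $UC$ is an eigenvector matrix for $T$. Then $M(\alpha,\beta)=\|UC\|\,\|(UC)^{-1}\|=\|C\|\,\|C^{-1}\|$. *)

theory Defs
  imports "HOL-Probability.Probability"
begin

definition objective :: "real^'d^'n \<Rightarrow> real^'n \<Rightarrow> real^'d \<Rightarrow> real" where
  "objective A b x = (1/2) * (norm (A *v x - b))\<^sup>2"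

definition frobenius_norm :: "real^'d^'n \<Rightarrow> real" where
  "frobenius_norm A = sqrt (\<Sum>i\<in>UNIV. \<Sum>j\<in>UNIV. (A $ i $ j)\<^sup>2)"

text \<open>Euclidean operator norm. For complex matrices the supremum is over complex vectors.\<close>

definition op_norm :: "'a::{real_normed_algebra_1}^'m^'n \<Rightarrow> real" where
  "op_norm A = onorm (\<lambda>x. A *v x)"

text \<open>\<open>lam\<close> lists the eigenvalues of \<open>G\<close> with their algebraic multiplicities: the characteristic
  polynomial of \<open>G\<close> factors as the product of the \<open>t - lam j\<close>.\<close>

definition eigenvalue_family :: "real^'d^'d \<Rightarrow> ('d \<Rightarrow> real) \<Rightarrow> bool" where
  "eigenvalue_family G lam \<longleftrightarrow> (\<forall>t. det (mat t - G) = (\<Prod>j\<in>UNIV. t - lam j))"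

definition minibatch_grad ::
  "real^'d^'n \<Rightarrow> real^'n \<Rightarrow> 'n pmf \<Rightarrow> nat \<Rightarrow> 'n list \<Rightarrow> real^'d \<Rightarrow> real^'d" where
  "minibatch_grad A b p B S x =
     (1 / real B) *\<^sub>R (\<Sum>j\<leftarrow>S. (1 / pmf p j) *\<^sub>R ((row j A \<bullet> x - b $ j) *\<^sub>R row j A))"

text \<open>The batch used in the step from \<open>x\<^sub>k\<close> to \<open>x\<^sub>k\<^sub>+\<^sub>1\<close> is \<open>S k\<close>, for \<open>k \<ge> 1\<close>; \<open>S 0\<close> is never used.\<close>

fun minibatch_hbm ::
  "real^'d^'n \<Rightarrow> real^'n \<Rightarrow> 'n pmf \<Rightarrow> nat \<Rightarrow> real \<Rightarrow> real \<Rightarrow> real^'d \<Rightarrow> (nat \<Rightarrow> 'n list) \<Rightarrow> nat \<Rightarrow> real^'d"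
where
  "minibatch_hbm A b p B \<alpha> \<beta> x0 S 0 = x0"
| "minibatch_hbm A b p B \<alpha> \<beta> x0 S (Suc 0) = x0"
| "minibatch_hbm A b p B \<alpha> \<beta> x0 S (Suc (Suc k)) =
     minibatch_hbm A b p B \<alpha> \<beta> x0 S (Suc k)
     - \<alpha> *\<^sub>R minibatch_grad A b p B (S (Suc k)) (minibatch_hbm A b p B \<alpha> \<beta> x0 S (Suc k))
     + \<beta> *\<^sub>R (minibatch_hbm A b p B \<alpha> \<beta> x0 S (Suc k) - minibatch_hbm A b p B \<alpha> \<beta> x0 S k)"

text \<open>The eigenvalues \<open>z\<^sup>+\<close>, \<open>z\<^sup>-\<close> of the \<open>2 \<times> 2\<close> matrix with rows \<open>(1 + \<beta> - \<alpha> l, -\<beta>)\<close> and \<open>(1, 0)\<close>.\<close>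

definition z_plus :: "real \<Rightarrow> real \<Rightarrow> real \<Rightarrow> complex" where
  "z_plus \<alpha> \<beta> l =
     (of_real (1 + \<beta> - \<alpha> * l) + csqrt (of_real ((1 + \<beta> - \<alpha> * l)\<^sup>2 - 4 * \<beta>))) / 2"

definition z_minus :: "real \<Rightarrow> real \<Rightarrow> real \<Rightarrow> complex" where
  "z_minus \<alpha> \<beta> l =
     (of_real (1 + \<beta> - \<alpha> * l) - csqrt (of_real ((1 + \<beta> - \<alpha> * l)\<^sup>2 - 4 * \<beta>))) / 2"

definition eigvec_block :: "real \<Rightarrow> real \<Rightarrow> real \<Rightarrow> complex^2^2" where
  "eigvec_block \<alpha> \<beta> l = vector [vector [z_plus \<alpha> \<beta> l, z_minus \<alpha> \<beta> l], vector [1, 1]]"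

text \<open>Index \<open>(j, r)\<close> stands for row or column \<open>r\<close> of the \<open>j\<close>-th diagonal block.\<close>

definition eigvec_matrix :: "real \<Rightarrow> real \<Rightarrow> ('d::finite \<Rightarrow> real) \<Rightarrow> complex^('d \<times> 2)^('d \<times> 2)" where
  "eigvec_matrix \<alpha> \<beta> lam =
     (\<chi> r s. if fst r = fst s then eigvec_block \<alpha> \<beta> (lam (fst r)) $ snd r $ snd s else 0)"

text \<open>An orthogonal change of basis \<open>U\<close> relates \<open>C = eigvec_matrix \<alpha> \<beta> lam\<close> to an eigenvector matrix
  \<open>U C\<close> of the iteration matrix; \<open>U\<close> does not affect the norms below.\<close>

definition hbm_cond :: "real \<Rightarrow> real \<Rightarrow> ('d::finite \<Rightarrow> real) \<Rightarrow> real" where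
  "hbm_cond \<alpha> \<beta> lam =
     op_norm (eigvec_matrix \<alpha> \<beta> lam) * op_norm (matrix_inv (eigvec_matrix \<alpha> \<beta> lam))"

end

theory Submission
  imports Defs
begin

text \<open>Measure the pair of errors at two consecutive steps by its \<open>energy\<close>, the squared norm of its
  coordinates in the eigenvectors of the iteration matrix. The two eigenvalues of each block have
  modulus \<open>sqrt \<beta>\<close>, so the noiseless iteration multiplies the energy by exactly \<open>\<beta>\<close>. Since
  \<open>A x* = b\<close>, the gradient noise is linear in the current error, and it is centred and independent
  of the past. As the energy is a quadratic form, the cross term vanishes in expectation, and one
  step multiplies the expected energy by at most
  \<open>\<beta> + M\<^sup>2 \<alpha>\<^sup>2 \<eta> \<parallel>A\<parallel>\<^sub>F\<^sup>2 \<parallel>A\<parallel>\<^sup>2 / B \<le> \<beta> (1 + ln k* / k*)\<close>.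
  Jensen's inequality then bounds the first moment, without any concentration inequality for matrix
  products.\<close>

subsection \<open>Spectral theorem for self-adjoint operators\<close>

text \<open>A maximiser of the Rayleigh quotient on the unit sphere of \<open>W\<close> is an
  eigenvector: otherwise moving along the residual \<open>f x - m *\<^sub>R x\<close>, which stays
  in \<open>W\<close>, would increase the quotient to first order.\<close>

lemma self_adjoint_eigenvector_in_subspace:
  fixes f :: "'a::euclidean_space \<Rightarrow> 'a"
  assumes f: "linear f" and sa: "\<And>x y. x \<bullet> f y = f x \<bullet> y"
    and W: "subspace W" "\<And>x. x \<in> W \<Longrightarrow> f x \<in> W" and ne: "x0 \<in> W" "x0 \<noteq> 0"
  obtains x m where "x \<in> W" "norm x = 1" "f x = m *\<^sub>R x"
proof -
  let ?K = "sphere 0 1 \<inter> W"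
  have "compact ?K"
    using W(1) by (intro compact_Int_closed closed_subspace) auto
  moreover have "(1 / norm x0) *\<^sub>R x0 \<in> ?K"
    using ne W(1) by (auto simp: subspace_scale)
  then have "?K \<noteq> {}" by blast
  moreover have "continuous_on ?K (\<lambda>x. x \<bullet> f x)"
    by (intro continuous_intros linear_continuous_on linear_conv_bounded_linear[THEN iffD1] f)
  ultimately obtain x where x: "x \<in> ?K" and sup: "\<forall>y\<in>?K. y \<bullet> f y \<le> x \<bullet> f x"
    using continuous_attains_sup[of ?K "\<lambda>x. x \<bullet> f x"] by blast
  define m where "m = x \<bullet> f x"
  have xx: "x \<bullet> x = 1" "norm x = 1" "x \<in> W"
    using x by (auto simp: dot_square_norm)
  have le: "y \<bullet> f y \<le> m * (y \<bullet> y)" if "y \<in> W" for y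
  proof (cases "y = 0")
    case True
    then show ?thesis by simp
  next
    case False
    then have "(1 / norm y) *\<^sub>R y \<in> ?K"
      using that W(1) by (auto simp: subspace_scale)
    then have "((1 / norm y) *\<^sub>R y) \<bullet> f ((1 / norm y) *\<^sub>R y) \<le> m"
      using sup m_def by blast
    then have "(y \<bullet> f y) / (norm y)\<^sup>2 \<le> m"
      by (simp add: linear_scale[OF f] power2_eq_square)
    then show ?thesis
      using False by (simp add: field_simps power2_norm_eq_inner)
  qed
  define w where "w = f x - m *\<^sub>R x"
  have wW: "w \<in> W"
    unfolding w_def using W xx by (intro subspace_diff subspace_scale) auto
  define c where "c = m * (w \<bullet> w) - w \<bullet> f w"
  \<comment> \<open>This is \<open>le\<close> at \<open>x + t *\<^sub>R w\<close>: the constant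
    terms cancel, self-adjointness doubles the linear one, and
    \<open>w \<bullet> f x - m * (w \<bullet> x)\<close> is \<open>w \<bullet> w\<close>.\<close>
  have quad: "2 * t * (w \<bullet> w) \<le> t\<^sup>2 * c" for t
  proof -
    have "x + t *\<^sub>R w \<in> W"
      using W(1) wW xx by (intro subspace_add subspace_scale) auto
    from le[OF this]
    have "m + 2 * t * (w \<bullet> f x) + t\<^sup>2 * (w \<bullet> f w)
        \<le> m * (1 + 2 * t * (w \<bullet> x) + t\<^sup>2 * (w \<bullet> w))"
      using sa[of x w]
      by (simp add: linear_add[OF f] linear_scale[OF f] inner_add_left inner_add_right m_def xx
          power2_eq_square inner_commute algebra_simps)
    note expanded = this
    have "2 * t * (w \<bullet> w) = 2 * t * (w \<bullet> f x - m * (w \<bullet> x))"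
      by (simp add: w_def inner_diff_right)
    also have "\<dots> \<le> t\<^sup>2 * (m * (w \<bullet> w) - w \<bullet> f w)"
      using expanded by (simp add: algebra_simps)
    finally show ?thesis
      unfolding c_def .
  qed
  have "w \<bullet> w = 0"
  proof (rule ccontr)
    assume "w \<bullet> w \<noteq> 0"
    then have pos: "w \<bullet> w > 0" by (simp add: order_less_le)
    \<comment> \<open>Chosen so small that \<open>t * c\<close> cannot exceed
      \<open>w \<bullet> w\<close>; the added 1 covers \<open>c = 0\<close>.\<close>
    define t where "t = (w \<bullet> w) / (\<bar>c\<bar> + 1)"
    have t: "t > 0" "t * (\<bar>c\<bar> + 1) = w \<bullet> w"
      using pos by (auto simp: t_def)
    have "2 * (w \<bullet> w) \<le> t * c"
      using quad[of t] t(1) by (simp add: power2_eq_square mult.assoc)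
    also have "\<dots> \<le> t * (\<bar>c\<bar> + 1)"
      using t by (intro mult_left_mono) auto
    finally show False using t pos by linarith
  qed
  then have "f x = m *\<^sub>R x" by (simp add: w_def)
  with xx show thesis using that by blast
qed

text \<open>Orthonormal sets of eigenvectors are independent, so their sizes are bounded by the
  dimension and a largest one exists. If it did not span, its orthogonal complement would be a
  nonzero invariant subspace and contain one more eigenvector.\<close>

lemma self_adjoint_orthonormal_eigenbasis:
  fixes f :: "'a::euclidean_space \<Rightarrow> 'a"
  assumes f: "linear f" and sa: "\<And>x y. x \<bullet> f y = f x \<bullet> y"
  shows "\<exists>V \<mu>. pairwise orthogonal V \<and> (\<forall>v\<in>V. norm v = 1) \<and> span V = UNIV
    \<and> (\<forall>v\<in>V. f v = \<mu> v *\<^sub>R v)"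
proof -
  let ?P = "\<lambda>V. pairwise orthogonal V \<and> (\<forall>v\<in>V. norm v = 1 \<and> (\<exists>m. f v = m *\<^sub>R v))"
  have "card V < DIM('a) + 1" if "?P V" for V
  proof -
    have "0 \<notin> V" using that by force
    then show ?thesis
      using that pairwise_orthogonal_independent[of V] independent_bound[of V] by auto
  qed
  moreover have "?P {}" by simp
  ultimately have "\<exists>V. ?P V \<and> (\<forall>U. ?P U \<longrightarrow> card U \<le> card V)"
    by (intro ex_has_greatest_nat[of ?P "{}" card "DIM('a) + 1"]) auto
  then obtain V where V: "?P V" and mx: "\<And>U. ?P U \<Longrightarrow> card U \<le> card V"
    by blast
  have fin: "finite V" using V pairwise_orthogonal_imp_finite by blast
  obtain \<mu> where \<mu>: "\<And>v. v \<in> V \<Longrightarrow> f v = \<mu> v *\<^sub>R v"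
    using V by metis
  have "span V = UNIV"
  proof (rule ccontr)
    assume "span V \<noteq> UNIV"
    then have "dim V < DIM('a)"
      using dim_eq_full[of V] dim_subset_UNIV[of V] by linarith
    then obtain x0 where x0: "x0 \<noteq> 0" "\<And>y. y \<in> span V \<Longrightarrow> orthogonal x0 y"
      using orthogonal_to_subspace_exists by blast
    let ?W = "{y. \<forall>v\<in>V. orthogonal v y}"
    \<comment> \<open>Invariance: \<open>v \<bullet> f y = f v \<bullet> y\<close>, and
      \<open>f v\<close> is a multiple of \<open>v\<close>.\<close>
    have "f y \<in> ?W" if "y \<in> ?W" for y
      using that by (auto simp: orthogonal_def sa \<mu>)
    moreover have "x0 \<in> ?W"
      using x0 by (auto simp: orthogonal_commute span_base)
    ultimately obtain x m where x: "x \<in> ?W" "norm x = 1" "f x = m *\<^sub>R x"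
      using self_adjoint_eigenvector_in_subspace[OF f sa subspace_orthogonal_to_vectors] x0(1)
      by blast
    have "x \<notin> V"
      using x by (auto simp: orthogonal_def)
    moreover have "?P (insert x V)"
      using V x by (auto simp: pairwise_insert orthogonal_commute)
    ultimately show False
      using mx[of "insert x V"] fin by simp
  qed
  then show ?thesis using V \<mu> by blast
qed

lemma norm_square_orthonormal_basis:
  fixes x :: "'a::euclidean_space"
  assumes "pairwise orthogonal V" "\<And>v. v \<in> V \<Longrightarrow> norm v = 1" "span V = UNIV"
  shows "(norm x)\<^sup>2 = (\<Sum>v\<in>V. (x \<bullet> v)\<^sup>2)"
proof -
  have "x = (\<Sum>v\<in>V. (x \<bullet> v) *\<^sub>R v)"
    using orthonormal_basis_expand[of V x] assms pairwise_orthogonal_imp_finite[of V] by simp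
  then have "x \<bullet> x = x \<bullet> (\<Sum>v\<in>V. (x \<bullet> v) *\<^sub>R v)" by simp
  also have "\<dots> = (\<Sum>v\<in>V. (x \<bullet> v)\<^sup>2)"
    by (simp add: inner_sum_right power2_eq_square)
  finally show ?thesis by (simp add: power2_norm_eq_inner)
qed

text \<open>\<open>mat m - G\<close> kills \<open>v\<close>, so its determinant, the characteristic
  polynomial at \<open>m\<close>, vanishes. This links the eigenbasis to the given list
  \<open>lam\<close>.\<close>

lemma eigenvalue_in_family:
  fixes G :: "real^'d^'d"
  assumes "eigenvalue_family G lam" "G *v v = m *\<^sub>R v" "v \<noteq> 0"
  shows "m \<in> range lam"
proof -
  have "mat m *v v = m *\<^sub>R v"
    by (simp add: vec_eq_iff mat_def matrix_vector_mult_def if_distrib if_distribR cong: if_cong)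
  then have "(mat m - G) *v v = 0"
    using assms(2) by (simp add: matrix_vector_mult_diff_rdistrib)
  then have "\<not> invertible (mat m - G)"
    using assms(3) inj_matrix_vector_mult[of "mat m - G"]
    by (metis injD matrix_vector_mult_0_right)
  then have "(\<Prod>j\<in>UNIV. m - lam j) = 0"
    using assms(1) by (simp add: invertible_det_nz eigenvalue_family_def)
  then show ?thesis by auto
qed

subsection \<open>Eigenvector coordinates of the iteration matrix\<close>

text \<open>Let z and its conjugate be the roots of \<open>t\<^sup>2 - \<tau> * t + \<beta>\<close>,
  with \<open>\<tau>\<^sup>2 < 4 * \<beta>\<close>. The bracket is the squared modulus of a - z b,
  the denominator that of the difference of the roots. Both eigenvector coordinates of (a, b) have
  the quotient as squared modulus, hence the factor 2.\<close>

definition block_energy :: "real \<Rightarrow> real \<Rightarrow> real \<Rightarrow> real \<Rightarrow> real" where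
  "block_energy \<beta> \<tau> a b = 2 * (a\<^sup>2 - \<tau> * a * b + \<beta> * b\<^sup>2) / (4 * \<beta> - \<tau>\<^sup>2)"

text \<open>In eigenvector coordinates the block multiplies each entry by an eigenvalue, of squared
  modulus \<beta>. In real form this is a polynomial identity.\<close>

lemma block_energy_step:
  "block_energy \<beta> \<tau> (\<tau> * a - \<beta> * b) a = \<beta> * block_energy \<beta> \<tau> a b"
  by (simp add: block_energy_def power2_eq_square algebra_simps)

text \<open>Noise enters only the newer of the two errors, so only the first argument is perturbed.
  The cross term is linear in \<open>c\<close> and therefore averages out for centred noise.\<close>

lemma block_energy_add:
  "block_energy \<beta> \<tau> (a + c) b = block_energy \<beta> \<tau> a b + block_energy \<beta> \<tau> c 0
     + c * (2 * (2 * a - \<tau> * b) / (4 * \<beta> - \<tau>\<^sup>2))"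
  by (simp add: block_energy_def divide_inverse power2_eq_square algebra_simps)

text \<open>The discriminant is negative, and \<open>csqrt\<close> of a negative real is the root on
  the positive imaginary axis.\<close>

lemma z_plus_eq:
  assumes "(1 + \<beta> - \<alpha> * l)\<^sup>2 < 4 * \<beta>"
  shows "z_plus \<alpha> \<beta> l =
    Complex ((1 + \<beta> - \<alpha> * l) / 2) (sqrt (4 * \<beta> - (1 + \<beta> - \<alpha> * l)\<^sup>2) / 2)"
proof -
  have "csqrt (of_real ((1 + \<beta> - \<alpha> * l)\<^sup>2 - 4 * \<beta>))
      = \<i> * sqrt (4 * \<beta> - (1 + \<beta> - \<alpha> * l)\<^sup>2)"
    using assms by (subst csqrt_of_real_nonpos) auto
  then show ?thesis
    unfolding z_plus_def by (simp add: complex_eq_iff)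
qed

lemma z_minus_eq:
  assumes "(1 + \<beta> - \<alpha> * l)\<^sup>2 < 4 * \<beta>"
  shows "z_minus \<alpha> \<beta> l = cnj (z_plus \<alpha> \<beta> l)"
proof -
  have "csqrt (of_real ((1 + \<beta> - \<alpha> * l)\<^sup>2 - 4 * \<beta>))
      = \<i> * sqrt (4 * \<beta> - (1 + \<beta> - \<alpha> * l)\<^sup>2)"
    using assms by (subst csqrt_of_real_nonpos) auto
  then show ?thesis
    unfolding z_plus_def z_minus_def by (simp add: complex_eq_iff)
qed

lemma z_plus_neq_z_minus:
  assumes "(1 + \<beta> - \<alpha> * l)\<^sup>2 < 4 * \<beta>"
  shows "z_plus \<alpha> \<beta> l \<noteq> z_minus \<alpha> \<beta> l"
  using assms by (simp add: z_minus_eq z_plus_eq complex_eq_iff)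

lemma sum_UNIV_times_2:
  fixes h :: "'d::finite \<times> 2 \<Rightarrow> 'b::comm_monoid_add"
  shows "(\<Sum>s\<in>UNIV. h s) = (\<Sum>i\<in>UNIV. h (i, 1) + h (i, 2))"
proof -
  have "(\<Sum>s\<in>UNIV. h s) = (\<Sum>(i, r)\<in>UNIV \<times> UNIV. h (i, r))" by simp
  also have "\<dots> = (\<Sum>i\<in>UNIV. \<Sum>r\<in>UNIV. h (i, r))"
    by (rule sum.cartesian_product[symmetric])
  finally show ?thesis by (simp add: sum_2)
qed

lemma eigvec_matrix_mult:
  "(eigvec_matrix \<alpha> \<beta> lam *v c) $ (j, 1)
     = z_plus \<alpha> \<beta> (lam j) * c $ (j, 1) + z_minus \<alpha> \<beta> (lam j) * c $ (j, 2)"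
  "(eigvec_matrix \<alpha> \<beta> lam *v c) $ (j, 2) = c $ (j, 1) + c $ (j, 2)"
  by (simp_all add: matrix_vector_mult_def eigvec_matrix_def eigvec_block_def sum_UNIV_times_2
      if_distrib if_distribR sum.distrib cong: if_cong)

text \<open>For a kernel vector the second row of each block makes its two entries opposite, and the
  first row then makes them zero because the two eigenvalues differ.\<close>

lemma invertible_eigvec_matrix:
  assumes "\<And>j. (1 + \<beta> - \<alpha> * lam j)\<^sup>2 < 4 * \<beta>"
  shows "invertible (eigvec_matrix \<alpha> \<beta> lam)"
proof -
  have "c = 0" if c: "eigvec_matrix \<alpha> \<beta> lam *v c = 0" for c
  proof -
    have "c $ (j, 1) = 0 \<and> c $ (j, 2) = 0" for j
    proof -
      have "z_plus \<alpha> \<beta> (lam j) * c $ (j, 1) + z_minus \<alpha> \<beta> (lam j) * c $ (j, 2) = 0"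
        and 2: "c $ (j, 2) = - c $ (j, 1)"
        using eigvec_matrix_mult[of \<alpha> \<beta> lam c j] c by (auto simp: add_eq_0_iff)
      then have "(z_plus \<alpha> \<beta> (lam j) - z_minus \<alpha> \<beta> (lam j)) * c $ (j, 1) = 0"
        by (simp add: algebra_simps)
      then show ?thesis
        using 2 z_plus_neq_z_minus[OF assms] by simp
    qed
    moreover have "s = (fst s, 1) \<or> s = (fst s, 2)" for s :: "'a \<times> 2"
      using exhaust_2[of "snd s"] by (cases s) auto
    ultimately show ?thesis
      by (metis vec_eq_iff zero_index)
  qed
  then show ?thesis
    by (simp add: invertible_left_inverse matrix_left_invertible_ker)
qed

lemma op_norm_nonneg:
  fixes A :: "'a::{euclidean_space, real_normed_algebra_1}^'m^'n"
  shows "0 \<le> op_norm A"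
  unfolding op_norm_def
  by (intro onorm_pos_le) (simp add: linear_conv_bounded_linear[symmetric])

lemma norm_matrix_vector_le_op_norm:
  fixes A :: "'a::{euclidean_space, real_normed_algebra_1}^'m^'n"
  shows "norm (A *v x) \<le> op_norm A * norm x"
  unfolding op_norm_def
  by (intro onorm) (simp add: linear_conv_bounded_linear[symmetric])

text \<open>The energy of \<open>(a, b)\<close> is the squared norm of the coordinates of \<open>(a, b)\<close> in the
  eigenvectors of the \<open>2 \<times> 2\<close> block.\<close>

lemma block_energy_coordinates:
  fixes lam :: "'d::finite \<Rightarrow> real"
  assumes "(1 + \<beta> - \<alpha> * lam j)\<^sup>2 < 4 * \<beta>"
  obtains c u where "eigvec_matrix \<alpha> \<beta> lam *v c = u" "(norm u)\<^sup>2 = a\<^sup>2 + b\<^sup>2"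
    "(norm c)\<^sup>2 = block_energy \<beta> (1 + \<beta> - \<alpha> * lam j) a b"
proof -
  define \<tau> where "\<tau> = 1 + \<beta> - \<alpha> * lam j"
  define s where "s = sqrt (4 * \<beta> - \<tau>\<^sup>2)"
  have s: "s > 0" "s\<^sup>2 = 4 * \<beta> - \<tau>\<^sup>2" using assms by (auto simp: s_def \<tau>_def)
  let ?z = "z_plus \<alpha> \<beta> (lam j)" and ?z' = "z_minus \<alpha> \<beta> (lam j)"
  have z: "?z = Complex (\<tau> / 2) (s / 2)" "?z' = Complex (\<tau> / 2) (- s / 2)"
    using assms by (simp_all add: z_minus_eq z_plus_eq s_def \<tau>_def complex_eq_iff)
  have ne: "?z - ?z' \<noteq> 0" using z s by (simp add: complex_eq_iff)
  \<comment> \<open>Cramer's rule for \<open>?z * c1 + ?z' * c2 = a\<close> and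
    \<open>c1 + c2 = b\<close>. The solution is placed in block \<open>j\<close> and padded with
    zeros.\<close>
  define c1 where "c1 = (a - ?z' * b) / (?z - ?z')"
  define c2 where "c2 = (?z * b - a) / (?z - ?z')"
  define c :: "complex^('d \<times> 2)" where
    "c = (\<chi> r. if fst r = j then if snd r = 1 then c1 else c2 else 0)"
  define u :: "complex^('d \<times> 2)" where
    "u = (\<chi> r. if fst r = j then if snd r = 1 then of_real a else of_real b else 0)"
  have c12: "?z * c1 + ?z' * c2 = a" "c1 + c2 = b"
    using ne by (simp_all add: c1_def c2_def divide_simps) (simp_all add: algebra_simps)
  have cu: "(eigvec_matrix \<alpha> \<beta> lam *v c) $ (i, 1) = u $ (i, 1)"
    "(eigvec_matrix \<alpha> \<beta> lam *v c) $ (i, 2) = u $ (i, 2)" for i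
    using c12 unfolding eigvec_matrix_mult by (auto simp: c_def u_def)
  have "eigvec_matrix \<alpha> \<beta> lam *v c = u"
  proof (rule vec_eq_iff[THEN iffD2], rule allI)
    fix r :: "'d \<times> 2"
    show "(eigvec_matrix \<alpha> \<beta> lam *v c) $ r = u $ r"
      using cu exhaust_2[of "snd r"] by (cases r) auto
  qed
  moreover have "(norm u)\<^sup>2 = a\<^sup>2 + b\<^sup>2"
    by (simp add: norm_vec_def L2_set_def sum_nonneg sum_UNIV_times_2 u_def
        if_distrib[of norm] if_distrib[of "\<lambda>x. x\<^sup>2"] sum.distrib cong: if_cong)
  moreover have "(norm c)\<^sup>2 = block_energy \<beta> \<tau> a b"
  proof -
    have n: "(cmod c1)\<^sup>2 = (a\<^sup>2 - \<tau> * a * b + \<beta> * b\<^sup>2) / s\<^sup>2"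
      "(cmod c2)\<^sup>2 = (a\<^sup>2 - \<tau> * a * b + \<beta> * b\<^sup>2) / s\<^sup>2"
    proof -
      have d: "(cmod (?z - ?z'))\<^sup>2 = s\<^sup>2"
        by (simp add: z cmod_power2)
      \<comment> \<open>The two numerators have the same modulus because \<open>a\<close> and
        \<open>b\<close> are real and the eigenvalues are conjugate.\<close>
      have e: "(cmod (a - ?z' * b))\<^sup>2 = (a - \<tau> / 2 * b)\<^sup>2 + s\<^sup>2 * b\<^sup>2 / 4"
        "(cmod (?z * b - a))\<^sup>2 = (a - \<tau> / 2 * b)\<^sup>2 + s\<^sup>2 * b\<^sup>2 / 4"
        unfolding z cmod_power2 by (simp_all add: power2_eq_square algebra_simps)
      have "(a - \<tau> / 2 * b)\<^sup>2 + s\<^sup>2 * b\<^sup>2 / 4 = a\<^sup>2 - \<tau> * a * b + \<beta> * b\<^sup>2"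
        unfolding s(2) by (simp add: power2_eq_square field_simps)
      then show "(cmod c1)\<^sup>2 = (a\<^sup>2 - \<tau> * a * b + \<beta> * b\<^sup>2) / s\<^sup>2"
        "(cmod c2)\<^sup>2 = (a\<^sup>2 - \<tau> * a * b + \<beta> * b\<^sup>2) / s\<^sup>2"
        unfolding c1_def c2_def norm_divide power_divide d e by simp_all
    qed
    have "(norm c)\<^sup>2 = (cmod c1)\<^sup>2 + (cmod c2)\<^sup>2"
      by (simp add: norm_vec_def L2_set_def sum_nonneg sum_UNIV_times_2 c_def
          if_distrib[of norm] if_distrib[of "\<lambda>x. x\<^sup>2"] sum.distrib cong: if_cong)
    then show ?thesis
      unfolding n block_energy_def s(2) by simp
  qed
  ultimately show thesis using that unfolding \<tau>_def by blast
qed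

text \<open>With \<open>u\<close> the padded pair and \<open>c\<close> its coordinates,
  \<open>?C *v c = u\<close> and \<open>matrix_inv ?C *v u = c\<close>, so each norm is controlled
  by the other. The two constants do not depend on \<open>j\<close>, and their product is the square
  of \<open>hbm_cond\<close>.\<close>

lemma block_energy_bounds:
  fixes lam :: "'d::finite \<Rightarrow> real"
  assumes "\<And>j. (1 + \<beta> - \<alpha> * lam j)\<^sup>2 < 4 * \<beta>"
  shows "block_energy \<beta> (1 + \<beta> - \<alpha> * lam j) a b
      \<le> (op_norm (matrix_inv (eigvec_matrix \<alpha> \<beta> lam)))\<^sup>2 * (a\<^sup>2 + b\<^sup>2)"
    and "a\<^sup>2 + b\<^sup>2
      \<le> (op_norm (eigvec_matrix \<alpha> \<beta> lam))\<^sup>2 * block_energy \<beta> (1 + \<beta> - \<alpha> * lam j) a b"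
proof -
  let ?C = "eigvec_matrix \<alpha> \<beta> lam"
  obtain c u where cu: "?C *v c = u" "(norm u)\<^sup>2 = a\<^sup>2 + b\<^sup>2"
    "(norm c)\<^sup>2 = block_energy \<beta> (1 + \<beta> - \<alpha> * lam j) a b"
    by (rule block_energy_coordinates[of \<beta> \<alpha> lam j, OF assms])
  have "invertible ?C"
    using assms by (rule invertible_eigvec_matrix)
  then have "?C ** matrix_inv ?C = mat 1 \<and> matrix_inv ?C ** ?C = mat 1"
    unfolding invertible_def matrix_inv_def by (rule someI_ex)
  then have "matrix_inv ?C *v u = c"
    using cu(1) by (metis matrix_vector_mul_assoc matrix_vector_mul_lid)
  then have "norm c \<le> op_norm (matrix_inv ?C) * norm u"
    using norm_matrix_vector_le_op_norm[of "matrix_inv ?C" u] by simp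
  from power_mono[OF this, of 2]
  show "block_energy \<beta> (1 + \<beta> - \<alpha> * lam j) a b \<le> (op_norm (matrix_inv ?C))\<^sup>2 * (a\<^sup>2 + b\<^sup>2)"
    by (simp add: power_mult_distrib cu)
  have "norm u \<le> op_norm ?C * norm c"
    using norm_matrix_vector_le_op_norm[of ?C c] cu(1) by simp
  from power_mono[OF this, of 2]
  show "a\<^sup>2 + b\<^sup>2 \<le> (op_norm ?C)\<^sup>2 * block_energy \<beta> (1 + \<beta> - \<alpha> * lam j) a b"
    by (simp add: power_mult_distrib cu)
qed

subsection \<open>Independent samples\<close>

lemma finite_set_replicate_pmf:
  "finite (set_pmf p) \<Longrightarrow> finite (set_pmf (replicate_pmf n p))"
  using finite_lists_length_eq[of "set_pmf p" n]
  by (simp add: set_replicate_pmf lists_eq_set)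

lemma replicate_pmf_Suc_pair:
  "replicate_pmf (Suc n) p = map_pmf (\<lambda>(x, xs). x # xs) (pair_pmf p (replicate_pmf n p))"
  by (simp add: pair_pmf_def map_bind_pmf bind_return_pmf)

lemma pmf_replicate_pmf:
  "pmf (replicate_pmf n p) xs = (if length xs = n then \<Prod>x\<leftarrow>xs. pmf p x else 0)"
proof (induction n arbitrary: xs)
  case 0
  then show ?case by (auto simp: pmf_return)
next
  case (Suc n)
  show ?case
  proof (cases xs)
    case Nil
    then show ?thesis
      by (auto simp: pmf_eq_0_set_pmf set_replicate_pmf simp del: replicate_pmf.simps)
  next
    case (Cons y ys)
    have "inj (\<lambda>(x, xs). x # xs)" by (auto simp: inj_def)
    then have "pmf (replicate_pmf (Suc n) p) ((\<lambda>(x, xs). x # xs) (y, ys))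
        = pmf (pair_pmf p (replicate_pmf n p)) (y, ys)"
      unfolding replicate_pmf_Suc_pair by (rule pmf_map_inj')
    then show ?thesis
      using Cons Suc.IH[of ys] by (simp add: pmf_pair del: replicate_pmf.simps)
  qed
qed

lemma expectation_replicate_pmf_Suc:
  fixes h :: "'a list \<Rightarrow> 'b::{banach, second_countable_topology}"
  assumes "finite (set_pmf p)"
  shows "measure_pmf.expectation (replicate_pmf (Suc n) p) h =
    measure_pmf.expectation p
      (\<lambda>x. measure_pmf.expectation (replicate_pmf n p) (\<lambda>xs. h (x # xs)))"
proof -
  have "replicate_pmf (Suc n) p = p \<bind> (\<lambda>x. map_pmf ((#) x) (replicate_pmf n p))"
    by (simp add: map_pmf_def)
  then show ?thesis
    using assms finite_set_replicate_pmf[OF assms, of n]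
    by (simp add: pmf_expectation_bind[of "set_pmf p"] integral_measure_pmf[of "set_pmf p"]
        del: replicate_pmf.simps)
qed

text \<open>Fubini for finite supports. It lets the newest batch be averaged first while the earlier
  ones are held fixed.\<close>

lemma expectation_swap:
  fixes h :: "'a \<Rightarrow> 'b \<Rightarrow> 'c::{banach, second_countable_topology}"
  assumes "finite (set_pmf p)" "finite (set_pmf q)"
  shows "measure_pmf.expectation p (\<lambda>x. measure_pmf.expectation q (h x)) =
    measure_pmf.expectation q (\<lambda>y. measure_pmf.expectation p (\<lambda>x. h x y))"
  using assms
  by (simp add: integral_measure_pmf[of "set_pmf p"] integral_measure_pmf[of "set_pmf q"]
      scaleR_sum_right mult.commute sum.swap[of _ "set_pmf p"])

lemma expectation_norm_add_square:
  fixes h :: "'a \<Rightarrow> 'b::euclidean_space"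
  assumes "finite (set_pmf p)" "measure_pmf.expectation p h = 0"
  shows "measure_pmf.expectation p (\<lambda>x. (norm (c + h x))\<^sup>2) =
    (norm c)\<^sup>2 + measure_pmf.expectation p (\<lambda>x. (norm (h x))\<^sup>2)"
proof -
  note int = integrable_measure_pmf_finite[OF assms(1)]
  have "measure_pmf.expectation p (\<lambda>x. (norm (c + h x))\<^sup>2) =
      measure_pmf.expectation p (\<lambda>x. (norm c)\<^sup>2 + 2 * (c \<bullet> h x) + (norm (h x))\<^sup>2)"
    by (simp add: power2_norm_eq_inner inner_add_left inner_add_right inner_commute algebra_simps)
  also have "\<dots> = (norm c)\<^sup>2 + 2 * (c \<bullet> measure_pmf.expectation p h)
      + measure_pmf.expectation p (\<lambda>x. (norm (h x))\<^sup>2)"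
    by (simp add: int)
  finally show ?thesis using assms(2) by simp
qed

text \<open>Second moments of independent centred vectors add up. In the induction the head of the
  list is fixed and acts as the constant in \<open>expectation_norm_add_square\<close>, while the
  tail is centred by the first claim.\<close>

lemma expectation_replicate_pmf_sum_list:
  fixes g :: "'a \<Rightarrow> 'b::euclidean_space"
  assumes fin: "finite (set_pmf p)" and mean: "measure_pmf.expectation p g = 0"
  shows "measure_pmf.expectation (replicate_pmf n p) (\<lambda>xs. \<Sum>x\<leftarrow>xs. g x) = 0"
    and "measure_pmf.expectation (replicate_pmf n p) (\<lambda>xs. (norm (\<Sum>x\<leftarrow>xs. g x))\<^sup>2) =
      real n * measure_pmf.expectation p (\<lambda>x. (norm (g x))\<^sup>2)"
proof (induction n)
  case 0
  { case 1 then show ?case by simp }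
  { case 2 then show ?case by simp }
next
  case (Suc n)
  note int = integrable_measure_pmf_finite[OF fin]
    integrable_measure_pmf_finite[OF finite_set_replicate_pmf[OF fin]]
  { case 1
    then show ?case
      using mean Suc(1)
      by (simp add: expectation_replicate_pmf_Suc[OF fin] int del: replicate_pmf.simps) }
  { case 2
    then show ?case
      using mean Suc
      by (simp add: expectation_replicate_pmf_Suc[OF fin] int algebra_simps
          expectation_norm_add_square[OF finite_set_replicate_pmf[OF fin]]
          del: replicate_pmf.simps) }
qed

text \<open>The variance is nonnegative.\<close>

lemma expectation_square_le:
  fixes h :: "'a \<Rightarrow> real"
  assumes "finite (set_pmf p)"
  shows "(measure_pmf.expectation p h)\<^sup>2 \<le> measure_pmf.expectation p (\<lambda>x. (h x)\<^sup>2)"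
  using measure_pmf.variance_eq[of p h] measure_pmf.variance_positive[of p h]
  by (simp add: integrable_measure_pmf_finite[OF assms])

lemma expectation_norm_centered_square_le:
  fixes g :: "'a \<Rightarrow> 'b::euclidean_space"
  assumes fin: "finite (set_pmf p)" and m: "measure_pmf.expectation p g = m"
  shows "measure_pmf.expectation p (\<lambda>x. (norm (g x - m))\<^sup>2)
    \<le> measure_pmf.expectation p (\<lambda>x. (norm (g x))\<^sup>2)"
proof -
  have "measure_pmf.expectation p (\<lambda>x. g x - m) = 0"
    using m by (simp add: integrable_measure_pmf_finite[OF fin])
  from expectation_norm_add_square[OF fin this, of m] show ?thesis by simp
qed

text \<open>Lists over a countable type are countably many, so measurability and law can be checked
  on singletons. The preimage of one list is a finite intersection of events, whose probability
  factors by independence.\<close>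

lemma (in prob_space) distr_map_indep_vars:
  fixes X :: "'i \<Rightarrow> 'a \<Rightarrow> 'b::countable"
  assumes ind: "indep_vars (\<lambda>_. count_space UNIV) X I" and J: "distinct js" "set js \<subseteq> I"
    and q: "\<And>i. i \<in> I \<Longrightarrow> distr M (count_space UNIV) (X i) = measure_pmf q"
  shows "(\<lambda>\<omega>. map (\<lambda>i. X i \<omega>) js) \<in> measurable M (count_space UNIV)"
    and "distr M (count_space UNIV) (\<lambda>\<omega>. map (\<lambda>i. X i \<omega>) js)
      = measure_pmf (replicate_pmf (length js) q)"
proof -
  let ?Y = "\<lambda>\<omega>. map (\<lambda>i. X i \<omega>) js"
  have meas: "X i \<in> measurable M (count_space UNIV)" if "i \<in> I" for i
    using ind that by (simp add: indep_vars_def2)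
  have pre: "?Y -` {xs} \<inter> space M \<in> events
      \<and> prob (?Y -` {xs} \<inter> space M) = pmf (replicate_pmf (length js) q) xs" for xs
  proof (cases "length xs = length js")
    case False
    then have "?Y -` {xs} = {}" by auto
    then show ?thesis using False by (simp add: pmf_replicate_pmf)
  next
    case True
    \<comment> \<open>The value that \<open>xs\<close> prescribes for the index \<open>i\<close>;
      well defined since the indices in \<open>js\<close> are distinct.\<close>
    define f where "f = the \<circ> map_of (zip js xs)"
    have xs: "xs = map f js"
      using True J(1) by (auto simp: f_def list_eq_iff_nth_eq map_of_zip_nth)
    show ?thesis
    \<comment> \<open>An empty intersection would be the whole type instead of
      \<open>space M\<close>, so the empty list is treated apart.\<close>
    proof (cases "js = []")
      case True
      then show ?thesis using xs by (simp add: prob_space)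
    next
      case False
      have eq: "?Y -` {xs} \<inter> space M = (\<Inter>i\<in>set js. X i -` {f i} \<inter> space M)"
        using False by (auto simp: xs)
      have ev: "X i -` {f i} \<inter> space M \<in> events" if "i \<in> set js" for i
        using meas[of i] J(2) that by (auto intro: measurable_sets)
      have "prob (X i -` {f i} \<inter> space M) = pmf q (f i)" if "i \<in> set js" for i
      proof -
        have "i \<in> I" using that J(2) by auto
        then have "measure (distr M (count_space UNIV) (X i)) {f i} = pmf q (f i)"
          by (simp add: q pmf.rep_eq)
        then show ?thesis
          using meas[OF \<open>i \<in> I\<close>] by (simp add: measure_distr)
      qed
      moreover have "prob (\<Inter>i\<in>set js. X i -` {f i} \<inter> space M)
          = (\<Prod>i\<in>set js. prob (X i -` {f i} \<inter> space M))"
        using False J(2) by (intro indep_varsD[OF ind]) auto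
      ultimately have "prob (?Y -` {xs} \<inter> space M) = (\<Prod>i\<in>set js. pmf q (f i))"
        unfolding eq by simp
      also have "\<dots> = (\<Prod>x\<leftarrow>xs. pmf q x)"
        using J(1) by (simp add: xs prod.distinct_set_conv_list o_def)
      finally have "prob (?Y -` {xs} \<inter> space M) = pmf (replicate_pmf (length js) q) xs"
        by (simp add: pmf_replicate_pmf \<open>length xs = length js\<close>)
      moreover have "?Y -` {xs} \<inter> space M \<in> events"
        unfolding eq using ev False by (intro sets.finite_INT) auto
      ultimately show ?thesis by blast
    qed
  qed
  then show Y: "?Y \<in> measurable M (count_space UNIV)"
    by (intro measurable_count_space_eq2_countable[THEN iffD2]) auto
  show "distr M (count_space UNIV) ?Y = measure_pmf (replicate_pmf (length js) q)"
  proof (rule measure_eqI_countable[where A = UNIV])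
    fix xs
    show "emeasure (distr M (count_space UNIV) ?Y) {xs}
        = emeasure (replicate_pmf (length js) q) {xs}"
      using pre[of xs] by (simp add: emeasure_distr[OF Y] emeasure_eq_measure emeasure_pmf_single)
  qed auto
qed

subsection \<open>Energy of the minibatch heavy ball iteration\<close>

lemma norm_matrix_vector_square:
  fixes A :: "real^'d^'n"
  shows "(norm (A *v x))\<^sup>2 = (\<Sum>j\<in>UNIV. (row j A \<bullet> x)\<^sup>2)"
  by (simp add: norm_vec_def L2_set_def sum_nonneg matrix_vector_mul_component row_def)

lemma gram_matrix_vector:
  fixes A :: "real^'d^'n"
  shows "(transpose A ** A) *v x = (\<Sum>j\<in>UNIV. (row j A \<bullet> x) *\<^sub>R row j A)"
proof -
  have "transpose A *v y = (\<Sum>j\<in>UNIV. y $ j *\<^sub>R row j A)" for y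
    by (simp add: vec_eq_iff matrix_vector_mult_def transpose_def row_def mult.commute
        del: transpose_matrix_vector)
  then show ?thesis
    by (simp add: matrix_vector_mul_assoc[symmetric] matrix_vector_mul_component row_def
        del: transpose_matrix_vector)
qed

lemma gram_matrix_inner:
  fixes A :: "real^'d^'n"
  shows "x \<bullet> ((transpose A ** A) *v y) = (A *v x) \<bullet> (A *v y)"
  by (metis dot_lmul_matrix inner_commute matrix_vector_mul_assoc transpose_matrix_vector)

lemma minibatch_grad_shift:
  "minibatch_grad A (A *v z) p B S x = minibatch_grad A 0 p B S (x - z)"
  by (simp add: minibatch_grad_def matrix_vector_mul_component row_def inner_diff_right)

text \<open>For the right-hand side \<open>A *v z\<close> every stochastic gradient vanishes at
  \<open>z\<close>. The errors thus follow the same iteration with right-hand side 0, which is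
  linear.\<close>

lemma minibatch_hbm_shift:
  "minibatch_hbm A (A *v z) p B \<alpha> \<beta> x0 S k - z = minibatch_hbm A 0 p B \<alpha> \<beta> (x0 - z) S k"
proof (induction k rule: induct_nat_012)
  case (ge2 k)
  show ?case
    by (simp add: minibatch_grad_shift flip: ge2)
qed simp_all

text \<open>The batches are listed from the most recent to the oldest.\<close>

primrec hbm_state ::
  "real^'d^'n \<Rightarrow> 'n pmf \<Rightarrow> nat \<Rightarrow> real \<Rightarrow> real \<Rightarrow> real^'d \<Rightarrow> 'n list list \<Rightarrow> (real^'d) \<times> (real^'d)"
where
  "hbm_state A p B \<alpha> \<beta> e [] = (e, e)"
| "hbm_state A p B \<alpha> \<beta> e (s # ss) =
     (let (x, y) = hbm_state A p B \<alpha> \<beta> e ss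
      in (x - \<alpha> *\<^sub>R minibatch_grad A 0 p B s x + \<beta> *\<^sub>R (x - y), x))"

text \<open>No batch gives the pair of iterates 1 and 0, both equal to \<open>e\<close>; after
  \<open>k\<close> batches the newer entry has index \<open>k + 1\<close> and the older one index
  \<open>k\<close>.\<close>

lemma hbm_state_eq:
  "hbm_state A p B \<alpha> \<beta> e (map S (rev [1..<Suc k]))
     = (minibatch_hbm A 0 p B \<alpha> \<beta> e S (Suc k), minibatch_hbm A 0 p B \<alpha> \<beta> e S k)"
  by (induction k) simp_all

text \<open>Splits the estimator into \<open>m\<close> and an average of \<open>B\<close>
  deviations; \<open>m\<close> will be the full gradient, which makes the deviations
  centred.\<close>

lemma minibatch_grad_centered:
  assumes "length s = B" "B > 0"
  shows "minibatch_grad A 0 p B s x =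
    m + (1 / real B) *\<^sub>R (\<Sum>j\<leftarrow>s. (1 / pmf p j) *\<^sub>R ((row j A \<bullet> x) *\<^sub>R row j A) - m)"
proof -
  have "(\<Sum>j\<leftarrow>s. g j - m) = (\<Sum>j\<leftarrow>s. g j) - real (length s) *\<^sub>R m" for g
    by (induction s) (simp_all add: algebra_simps)
  then show ?thesis
    unfolding minibatch_grad_def using assms by (simp add: scaleR_right_diff_distrib)
qed

text \<open>\<open>V\<close> is an orthonormal eigenbasis of the Gram matrix with eigenvalues
  \<open>\<mu>\<close>. The constants \<open>K\<close> and \<open>L\<close> compare block energy and
  Euclidean norm; they will be the squared operator norms of the inverse eigenvector matrix and of
  the eigenvector matrix, so that \<open>K * L\<close> is the square of
  \<open>hbm_cond\<close>.\<close>

locale hbm_energy =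
  fixes A :: "real^'d^'n" and p :: "'n pmf" and \<eta> \<alpha> \<beta> K L :: real
    and V :: "(real^'d) set" and \<mu> :: "real^'d \<Rightarrow> real"
  assumes orthogonal_V: "pairwise orthogonal V" and norm_V: "\<And>v. v \<in> V \<Longrightarrow> norm v = 1"
    and span_V: "span V = UNIV"
    and eigen: "\<And>v. v \<in> V \<Longrightarrow> (transpose A ** A) *v v = \<mu> v *\<^sub>R v"
    and p_pos: "\<And>j. pmf p j > 0"
    and p_eta: "\<And>j. (norm (row j A))\<^sup>2 \<le> \<eta> * (frobenius_norm A)\<^sup>2 * pmf p j"
    and beta_nonneg: "\<beta> \<ge> 0" and eta_nonneg: "\<eta> \<ge> 0" and K_nonneg: "K \<ge> 0" and L_nonneg: "L \<ge> 0"
    and block_le: "\<And>v a b. v \<in> V \<Longrightarrow>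
      block_energy \<beta> (1 + \<beta> - \<alpha> * \<mu> v) a b \<le> K * (a\<^sup>2 + b\<^sup>2)"
    and le_block: "\<And>v a b. v \<in> V \<Longrightarrow>
      a\<^sup>2 + b\<^sup>2 \<le> L * block_energy \<beta> (1 + \<beta> - \<alpha> * \<mu> v) a b"
begin

definition energy :: "real^'d \<Rightarrow> real^'d \<Rightarrow> real" where
  "energy x y = (\<Sum>v\<in>V. block_energy \<beta> (1 + \<beta> - \<alpha> * \<mu> v) (x \<bullet> v) (y \<bullet> v))"

lemma parseval: "(norm x)\<^sup>2 = (\<Sum>v\<in>V. (x \<bullet> v)\<^sup>2)"
  using orthogonal_V norm_V span_V by (rule norm_square_orthonormal_basis)

lemma energy_le: "energy x y \<le> K * ((norm x)\<^sup>2 + (norm y)\<^sup>2)"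
  unfolding energy_def parseval sum.distrib[symmetric] sum_distrib_left
  by (intro sum_mono block_le)

lemma le_energy: "(norm x)\<^sup>2 + (norm y)\<^sup>2 \<le> L * energy x y"
  unfolding energy_def parseval sum.distrib[symmetric] sum_distrib_left
  by (intro sum_mono le_block)

text \<open>The noiseless step decouples over \<open>V\<close>: along \<open>v\<close> it is the
  recurrence handled by \<open>block_energy_step\<close>.\<close>

lemma energy_mean_step:
  "energy (x - \<alpha> *\<^sub>R ((transpose A ** A) *v x) + \<beta> *\<^sub>R (x - y)) x = \<beta> * energy x y"
proof -
  have "block_energy \<beta> (1 + \<beta> - \<alpha> * \<mu> v)
      ((x - \<alpha> *\<^sub>R ((transpose A ** A) *v x) + \<beta> *\<^sub>R (x - y)) \<bullet> v) (x \<bullet> v)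
      = \<beta> * block_energy \<beta> (1 + \<beta> - \<alpha> * \<mu> v) (x \<bullet> v) (y \<bullet> v)" if "v \<in> V" for v
  proof -
    have "((transpose A ** A) *v x) \<bullet> v = \<mu> v * (x \<bullet> v)"
      using gram_matrix_inner[of v A x] gram_matrix_inner[of x A v] eigen[OF that]
      by (simp add: inner_commute)
    then have "(x - \<alpha> *\<^sub>R ((transpose A ** A) *v x) + \<beta> *\<^sub>R (x - y)) \<bullet> v
        = (1 + \<beta> - \<alpha> * \<mu> v) * (x \<bullet> v) - \<beta> * (y \<bullet> v)"
      by (simp add: inner_diff_left inner_add_left algebra_simps)
    then show ?thesis by (simp only: block_energy_step)
  qed
  then show ?thesis by (simp add: energy_def sum_distrib_left)
qed

text \<open>The vector \<open>u\<close> represents the cross term, which is linear in the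
  perturbation \<open>w\<close>; its coefficients along \<open>V\<close> come from
  \<open>block_energy_add\<close>.\<close>

lemma energy_add:
  "\<exists>u. \<forall>w. energy (x + w) y = energy x y + energy w 0 + w \<bullet> u"
proof (intro exI allI)
  define c where "c v = 2 * (2 * (x \<bullet> v) - (1 + \<beta> - \<alpha> * \<mu> v) * (y \<bullet> v))
    / (4 * \<beta> - (1 + \<beta> - \<alpha> * \<mu> v)\<^sup>2)" for v
  show "energy (x + w) y = energy x y + energy w 0 + w \<bullet> (\<Sum>v\<in>V. c v *\<^sub>R v)" for w
    by (simp add: energy_def inner_add_left block_energy_add[of _ _ "x \<bullet> _"] sum.distrib
        inner_sum_right c_def mult.commute)
qed

lemma expectation_energy_add_centered:
  assumes fin: "finite (set_pmf q)" and mean: "measure_pmf.expectation q w = 0"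
  shows "measure_pmf.expectation q (\<lambda>s. energy (x + w s) y)
    \<le> energy x y + K * measure_pmf.expectation q (\<lambda>s. (norm (w s))\<^sup>2)"
proof -
  note int = integrable_measure_pmf_finite[OF fin]
  obtain u where u: "\<And>w. energy (x + w) y = energy x y + energy w 0 + w \<bullet> u"
    using energy_add by blast
  have "measure_pmf.expectation q (\<lambda>s. energy (x + w s) y)
      = energy x y + measure_pmf.expectation q (\<lambda>s. energy (w s) 0)
        + measure_pmf.expectation q w \<bullet> u"
    by (simp add: u int)
  also have "measure_pmf.expectation q (\<lambda>s. energy (w s) 0)
      \<le> measure_pmf.expectation q (\<lambda>s. K * (norm (w s))\<^sup>2)"
    using energy_le[of _ 0] by (intro integral_mono int) auto
  finally show ?thesis using mean by (simp add: int)
qed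

text \<open>One factor \<open>1 / pmf p j\<close> cancels against the sampling weight;
  \<open>p_eta\<close> bounds the other together with the squared row norm, and the remaining sum is
  \<open>(norm (A *v x))\<^sup>2\<close>.\<close>

lemma second_moment_gradient:
  "measure_pmf.expectation p (\<lambda>j. (norm ((1 / pmf p j) *\<^sub>R ((row j A \<bullet> x) *\<^sub>R row j A)))\<^sup>2)
     \<le> \<eta> * (frobenius_norm A)\<^sup>2 * (norm (A *v x))\<^sup>2"
proof -
  have "pmf p j * (norm ((1 / pmf p j) *\<^sub>R ((row j A \<bullet> x) *\<^sub>R row j A)))\<^sup>2
      \<le> \<eta> * (frobenius_norm A)\<^sup>2 * (row j A \<bullet> x)\<^sup>2" for j
  proof -
    have "pmf p j * (norm ((1 / pmf p j) *\<^sub>R ((row j A \<bullet> x) *\<^sub>R row j A)))\<^sup>2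
        = (norm (row j A))\<^sup>2 / pmf p j * (row j A \<bullet> x)\<^sup>2"
      using p_pos[of j] by (simp add: power_mult_distrib power_divide power2_eq_square)
    also have "\<dots> \<le> \<eta> * (frobenius_norm A)\<^sup>2 * (row j A \<bullet> x)\<^sup>2"
      using p_eta[of j] p_pos[of j] by (intro mult_right_mono) (auto simp: divide_le_eq)
    finally show ?thesis .
  qed
  then show ?thesis
    unfolding norm_matrix_vector_square sum_distrib_left
    by (subst integral_measure_pmf[of UNIV]) (auto intro!: sum_mono)
qed

text \<open>Bound on the factor by which one step multiplies the expected energy: \<beta> from the
  mean step, the rest from the variance of a batch of size \<open>B\<close>.\<close>

definition growth :: "nat \<Rightarrow> real" where
  "growth B = \<beta> + K * L * \<alpha>\<^sup>2 * \<eta> * (frobenius_norm A)\<^sup>2 * (op_norm A)\<^sup>2 / real B"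

lemma growth_nonneg: "growth B \<ge> 0"
  unfolding growth_def using beta_nonneg K_nonneg L_nonneg eta_nonneg by simp

lemma expectation_energy_step:
  assumes B: "B > 0"
  shows "measure_pmf.expectation (replicate_pmf B p)
      (\<lambda>s. energy (x - \<alpha> *\<^sub>R minibatch_grad A 0 p B s x + \<beta> *\<^sub>R (x - y)) x)
    \<le> growth B * energy x y"
proof -
  let ?G = "transpose A ** A"
  define g where "g j = (1 / pmf p j) *\<^sub>R ((row j A \<bullet> x) *\<^sub>R row j A)" for j
  \<comment> \<open>The noise of the step: \<open>- \<alpha>\<close> times the deviation of the
    minibatch gradient from the full one.\<close>
  define w where "w s = (- \<alpha> / real B) *\<^sub>R (\<Sum>j\<leftarrow>s. g j - ?G *v x)" for s
  have fin: "finite (set_pmf p)" by simp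
  note finr = finite_set_replicate_pmf[OF fin, of B]
  note int = integrable_measure_pmf_finite[OF fin] integrable_measure_pmf_finite[OF finr]
  have mean: "measure_pmf.expectation p g = ?G *v x"
    using p_pos by (subst integral_measure_pmf[of UNIV])
      (simp_all add: g_def gram_matrix_vector less_imp_neq[THEN not_sym])
  then have cent: "measure_pmf.expectation p (\<lambda>j. g j - ?G *v x) = 0"
    by (simp add: int)
  have "measure_pmf.expectation (replicate_pmf B p)
      (\<lambda>s. energy (x - \<alpha> *\<^sub>R minibatch_grad A 0 p B s x + \<beta> *\<^sub>R (x - y)) x)
    = measure_pmf.expectation (replicate_pmf B p)
      (\<lambda>s. energy ((x - \<alpha> *\<^sub>R (?G *v x) + \<beta> *\<^sub>R (x - y)) + w s) x)"
  proof (rule integral_cong_AE)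
    \<comment> \<open>Only almost everywhere, since the decomposition needs batches of length
      exactly \<open>B\<close>.\<close>
    show "AE s in replicate_pmf B p.
        energy (x - \<alpha> *\<^sub>R minibatch_grad A 0 p B s x + \<beta> *\<^sub>R (x - y)) x
        = energy ((x - \<alpha> *\<^sub>R (?G *v x) + \<beta> *\<^sub>R (x - y)) + w s) x"
    proof (clarsimp simp: AE_measure_pmf_iff set_replicate_pmf)
      fix s :: "'n list"
      assume "B = length s"
      then have "minibatch_grad A 0 p B s x
          = ?G *v x + (1 / real B) *\<^sub>R (\<Sum>j\<leftarrow>s. g j - ?G *v x)"
        unfolding g_def using B by (intro minibatch_grad_centered) auto
      then have step: "x - \<alpha> *\<^sub>R minibatch_grad A 0 p B s x + \<beta> *\<^sub>R (x - y)
          = (x - \<alpha> *\<^sub>R (?G *v x) + \<beta> *\<^sub>R (x - y)) + w s"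
        by (simp add: w_def scaleR_right_distrib)
      show "energy (x - \<alpha> *\<^sub>R minibatch_grad A 0 p (length s) s x + \<beta> *\<^sub>R (x - y)) x
          = energy ((x - \<alpha> *\<^sub>R (?G *v x) + \<beta> *\<^sub>R (x - y)) + w s) x"
        by (simp only: \<open>B = length s\<close>[symmetric] step)
    qed
  qed auto
  also have "\<dots> \<le> energy (x - \<alpha> *\<^sub>R (?G *v x) + \<beta> *\<^sub>R (x - y)) x
      + K * measure_pmf.expectation (replicate_pmf B p) (\<lambda>s. (norm (w s))\<^sup>2)"
    by (intro expectation_energy_add_centered finr)
      (simp add: w_def int expectation_replicate_pmf_sum_list(1)[OF fin cent])
  \<comment> \<open>The \<open>B\<close> independent draws contribute a factor \<open>B\<close>
    against \<open>1 / B\<^sup>2\<close>, leaving the variance reduction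
    \<open>1 / B\<close>.\<close>
  also have "measure_pmf.expectation (replicate_pmf B p) (\<lambda>s. (norm (w s))\<^sup>2)
      = (\<alpha>\<^sup>2 / (real B)\<^sup>2) * (real B * measure_pmf.expectation p (\<lambda>j. (norm (g j - ?G *v x))\<^sup>2))"
    unfolding expectation_replicate_pmf_sum_list(2)[OF fin cent, symmetric]
    by (simp add: w_def power_mult_distrib power_divide)
  also have "\<dots> = \<alpha>\<^sup>2 / real B * measure_pmf.expectation p (\<lambda>j. (norm (g j - ?G *v x))\<^sup>2)"
    using B by (simp add: power2_eq_square)
  also have "\<dots> \<le> \<alpha>\<^sup>2 / real B * (\<eta> * (frobenius_norm A)\<^sup>2 * ((op_norm A)\<^sup>2 * (L * energy x y)))"
  proof (intro mult_left_mono)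
    have "measure_pmf.expectation p (\<lambda>j. (norm (g j - ?G *v x))\<^sup>2)
        \<le> \<eta> * (frobenius_norm A)\<^sup>2 * (norm (A *v x))\<^sup>2"
      using expectation_norm_centered_square_le[OF fin mean] second_moment_gradient[of x]
      unfolding g_def by linarith
    also have "\<dots> \<le> \<eta> * (frobenius_norm A)\<^sup>2 * ((op_norm A)\<^sup>2 * (L * energy x y))"
    proof (intro mult_left_mono)
      have "(norm (A *v x))\<^sup>2 \<le> (op_norm A)\<^sup>2 * (norm x)\<^sup>2"
        using power_mono[OF norm_matrix_vector_le_op_norm[of A x], of 2]
        by (simp add: power_mult_distrib)
      also have "\<dots> \<le> (op_norm A)\<^sup>2 * (L * energy x y)"
        using le_energy[of x y] by (intro mult_left_mono) (auto intro: order_trans[rotated])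
      finally show "(norm (A *v x))\<^sup>2 \<le> (op_norm A)\<^sup>2 * (L * energy x y)" .
    qed (use eta_nonneg in auto)
    finally show "measure_pmf.expectation p (\<lambda>j. (norm (g j - ?G *v x))\<^sup>2)
        \<le> \<eta> * (frobenius_norm A)\<^sup>2 * ((op_norm A)\<^sup>2 * (L * energy x y))" .
  qed auto
  finally have "measure_pmf.expectation (replicate_pmf B p)
      (\<lambda>s. energy (x - \<alpha> *\<^sub>R minibatch_grad A 0 p B s x + \<beta> *\<^sub>R (x - y)) x)
    \<le> energy (x - \<alpha> *\<^sub>R (?G *v x) + \<beta> *\<^sub>R (x - y)) x
      + K * (\<alpha>\<^sup>2 / real B * (\<eta> * (frobenius_norm A)\<^sup>2 * ((op_norm A)\<^sup>2 * (L * energy x y))))"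
    using K_nonneg by (simp add: mult_left_mono)
  then show ?thesis
    unfolding energy_mean_step by (simp add: growth_def algebra_simps)
qed

lemma expectation_energy_state:
  assumes B: "B > 0"
  shows "measure_pmf.expectation (replicate_pmf k (replicate_pmf B p))
      (\<lambda>ss. case hbm_state A p B \<alpha> \<beta> e ss of (x, y) \<Rightarrow> energy x y)
    \<le> growth B ^ k * energy e e"
proof (induction k)
  case 0
  then show ?case by simp
next
  case (Suc k)
  let ?q = "replicate_pmf B p" and ?st = "hbm_state A p B \<alpha> \<beta> e"
  let ?h = "\<lambda>ss. case ?st ss of (x, y) \<Rightarrow> energy x y"
  have fin: "finite (set_pmf ?q)" by (simp add: finite_set_replicate_pmf)
  note fin' = finite_set_replicate_pmf[OF fin, of k]
  note int = integrable_measure_pmf_finite[OF fin']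
  have "measure_pmf.expectation (replicate_pmf (Suc k) ?q) ?h
      = measure_pmf.expectation (replicate_pmf k ?q)
          (\<lambda>ss. measure_pmf.expectation ?q (\<lambda>s. ?h (s # ss)))"
    \<comment> \<open>The head of the list is the newest batch. Moving its average inside fixes the
      past, so the one-step bound applies.\<close>
    unfolding expectation_replicate_pmf_Suc[OF fin] by (rule expectation_swap[OF fin fin'])
  also have "\<dots> \<le> measure_pmf.expectation (replicate_pmf k ?q) (\<lambda>ss. growth B * ?h ss)"
    using expectation_energy_step[OF B] by (intro integral_mono int) (auto split: prod.split)
  also have "\<dots> = growth B * measure_pmf.expectation (replicate_pmf k ?q) ?h"
    by (simp add: int)
  also have "\<dots> \<le> growth B * (growth B ^ k * energy e e)"
    using Suc growth_nonneg by (intro mult_left_mono)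
  finally show ?case by (simp add: mult.assoc)
qed

text \<open>Jensen's inequality reduces the claim to second moments. \<open>L\<close> passes from
  norm to energy, \<open>K\<close> back to the initial error, and the 2 arises because the initial
  pair contains that error twice.\<close>

lemma expectation_norm_state:
  assumes B: "B > 0"
  shows "(measure_pmf.expectation (replicate_pmf k (replicate_pmf B p))
      (\<lambda>ss. norm (snd (hbm_state A p B \<alpha> \<beta> e ss))))\<^sup>2
    \<le> 2 * (K * L) * growth B ^ k * (norm e)\<^sup>2"
proof -
  let ?q = "replicate_pmf k (replicate_pmf B p)" and ?st = "hbm_state A p B \<alpha> \<beta> e"
  have fin: "finite (set_pmf ?q)" by (simp add: finite_set_replicate_pmf)
  note int = integrable_measure_pmf_finite[OF fin]
  have "(norm (snd (?st ss)))\<^sup>2 \<le> L * (case ?st ss of (x, y) \<Rightarrow> energy x y)" for ss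
    using le_energy[of "fst (?st ss)" "snd (?st ss)"] zero_le_power2[of "norm (fst (?st ss))"]
    unfolding case_prod_beta by linarith
  then have "measure_pmf.expectation ?q (\<lambda>ss. (norm (snd (?st ss)))\<^sup>2)
      \<le> measure_pmf.expectation ?q (\<lambda>ss. L * (case ?st ss of (x, y) \<Rightarrow> energy x y))"
    by (intro integral_mono int)
  also have "\<dots> = L * measure_pmf.expectation ?q (\<lambda>ss. case ?st ss of (x, y) \<Rightarrow> energy x y)"
    by (simp add: int)
  also have "\<dots> \<le> L * (growth B ^ k * (K * ((norm e)\<^sup>2 + (norm e)\<^sup>2)))"
    by (intro mult_left_mono order_trans[OF expectation_energy_state[OF B]] energy_le
        zero_le_power growth_nonneg L_nonneg)
  finally show ?thesis
    using expectation_square_le[OF fin, of "\<lambda>ss. norm (snd (?st ss))"]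
    by (simp add: algebra_simps)
qed

end

subsection \<open>The convergence rate\<close>

theorem theorem3p2:
  fixes A :: "real^'d^'n" and b :: "real^'n" and lam :: "'d \<Rightarrow> real"
    and p :: "'n pmf" and \<eta> \<alpha> \<beta> kstar :: real and B :: nat
    and x0 xstar :: "real^'d"
    and \<Omega> :: "'w measure" and S :: "nat \<Rightarrow> 'w \<Rightarrow> 'n list"
  assumes lam: "eigenvalue_family (transpose A ** A) lam"
    and lam_min_pos: "Min (range lam) > 0"
    and p_pos: "\<And>j. pmf p j > 0"
    and eta: "\<eta> \<ge> 1"
    and p_eta: "\<And>j. \<eta> * pmf p j \<ge> (norm (row j A))\<^sup>2 / (frobenius_norm A)\<^sup>2"
    and beta: "\<beta> \<ge> 0"
    and alpha_lower: "(1 - sqrt \<beta>)\<^sup>2 / Min (range lam) < \<alpha>"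
    and alpha_upper: "\<alpha> < (1 + sqrt \<beta>)\<^sup>2 / Max (range lam)"
    and kstar: "kstar > 1"
    and batch: "real B \<ge> 16 * exp 1 * \<eta> * ln (2 * real CARD('d)) *
        max ((frobenius_norm A)\<^sup>2 * (op_norm A)\<^sup>2 * \<alpha>\<^sup>2 * (hbm_cond \<alpha> \<beta> lam)\<^sup>2 * kstar
               / (\<beta> * ln kstar))
            (sqrt (2 * (frobenius_norm A)^4 * \<alpha>\<^sup>2 * (hbm_cond \<alpha> \<beta> lam)\<^sup>2 * kstar
               / (\<beta> * ln kstar)))"
    and prob: "prob_space \<Omega>"
    and S_indep: "prob_space.indep_vars \<Omega> (\<lambda>_. count_space UNIV) S {1..}"
    and S_distr: "\<And>k. k \<ge> 1 \<Longrightarrow>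
        distr \<Omega> (count_space UNIV) (S k) = measure_pmf (replicate_pmf B p)"
    and xstar_min: "is_arg_min (objective A b) (\<lambda>_. True) xstar"
    and consistent: "A *v xstar = b"
  shows "\<forall>k>0. prob_space.expectation \<Omega>
            (\<lambda>\<omega>. norm (minibatch_hbm A b p B \<alpha> \<beta> x0 (\<lambda>i. S i \<omega>) k - xstar))
         \<le> sqrt 2 * hbm_cond \<alpha> \<beta> lam
             * max (real CARD('d)) (kstar powr (real k / kstar))
             * sqrt \<beta> ^ k * norm (x0 - xstar)"
proof (intro allI impI)
  fix k :: nat
  assume "k > 0"
  let ?G = "transpose A ** A" and ?C = "eigvec_matrix \<alpha> \<beta> lam"
  define K where "K = (op_norm (matrix_inv ?C))\<^sup>2"
  define L where "L = (op_norm ?C)\<^sup>2"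
  define F where "F = frobenius_norm A"
  define N where "N = op_norm A"
  define M where "M = hbm_cond \<alpha> \<beta> lam"
  have M: "M \<ge> 0" "K * L = M\<^sup>2"
    by (simp_all add: M_def hbm_cond_def op_norm_nonneg K_def L_def power_mult_distrib)

  \<comment> \<open>Injectivity of \<open>A\<close> and positivity of its norms\<close>
  have lam_pos: "lam j > 0" for j
    using lam_min_pos by (simp add: Min_gr_iff)
  have A_inj: "A *v x \<noteq> 0" if "x \<noteq> 0" for x
  proof
    assume "A *v x = 0"
    then have "?G *v x = 0 *\<^sub>R x"
      by (simp add: matrix_vector_mul_assoc[symmetric] del: transpose_matrix_vector)
    then have "0 \<in> range lam"
      using eigenvalue_in_family[OF lam] that by blast
    then show False using lam_pos by (metis imageE less_irrefl)
  qed
  obtain x :: "real^'d" where x: "x \<noteq> 0"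
    using zero_neq_one by blast
  have N: "N > 0"
  proof -
    have "0 < norm (A *v x)" using A_inj[OF x] by simp
    also have "\<dots> \<le> N * norm x"
      unfolding N_def by (rule norm_matrix_vector_le_op_norm)
    finally show ?thesis using x by (simp add: zero_less_mult_iff)
  qed
  have F: "F > 0"
  proof (rule ccontr)
    assume "\<not> F > 0"
    then have "(\<Sum>i\<in>UNIV. \<Sum>j\<in>UNIV. (A $ i $ j)\<^sup>2) = 0"
      by (auto simp: F_def frobenius_norm_def not_less sum_nonneg intro!: antisym)
    then have "A = 0"
      by (simp add: sum_nonneg_eq_0_iff sum_nonneg vec_eq_iff)
    then show False using A_inj[OF x] by simp
  qed

  \<comment> \<open>Negative discriminants from the step size condition\<close>
  define r where "r = sqrt \<beta>"
  have r: "r \<ge> 0" "\<beta> = r\<^sup>2" using beta by (auto simp: r_def)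
  have Min_le: "Min (range lam) \<le> lam j" and le_Max: "lam j \<le> Max (range lam)" for j
    by auto
  have Max_pos: "Max (range lam) > 0"
    using lam_pos le_Max by (rule order_less_le_trans)
  have \<alpha>_Min: "(1 - r)\<^sup>2 < \<alpha> * Min (range lam)"
    using alpha_lower lam_min_pos by (simp add: r_def divide_less_eq)
  have \<alpha>_Max: "\<alpha> * Max (range lam) < (1 + r)\<^sup>2"
    using alpha_upper Max_pos by (simp add: r_def less_divide_eq)
  have \<alpha>: "\<alpha> > 0"
    using le_less_trans[OF zero_le_power2 \<alpha>_Min] lam_min_pos by (simp add: zero_less_mult_iff)
  have lower: "(1 - r)\<^sup>2 < \<alpha> * lam j" for j
    using \<alpha>_Min mult_left_mono[OF Min_le[of j], of \<alpha>] \<alpha> by linarith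
  have upper: "\<alpha> * lam j < (1 + r)\<^sup>2" for j
    using \<alpha>_Max mult_left_mono[OF le_Max[of j], of \<alpha>] \<alpha> by linarith
  \<comment> \<open>For \<open>r = 0\<close> the two bounds would read
    \<open>1 < \<alpha> * lam j < 1\<close>.\<close>
  have "r \<noteq> 0" using lower upper by (metis add_0_right diff_zero less_asym)
  then have \<beta>: "\<beta> > 0" using r by simp
  have disc: "(1 + \<beta> - \<alpha> * lam j)\<^sup>2 < 4 * \<beta>" for j
  proof -
    \<comment> \<open>\<open>lower\<close> makes the first factor positive and \<open>upper\<close>
      the second, as \<open>(1 - r)\<^sup>2\<close> and \<open>(1 + r)\<^sup>2\<close> are
      \<open>1 + \<beta>\<close> minus and plus \<open>2 * r\<close>.\<close>
    have "0 < (2 * r - (1 + \<beta> - \<alpha> * lam j)) * (2 * r + (1 + \<beta> - \<alpha> * lam j))"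
      using lower[of j] upper[of j] r(2)
      by (intro mult_pos_pos) (simp_all add: power2_eq_square algebra_simps)
    then show ?thesis
      unfolding r(2) by (simp add: power2_eq_square algebra_simps)
  qed
  note bounds = block_energy_bounds[of \<beta> \<alpha> lam, OF disc]

  \<comment> \<open>Eigenbasis of the Gram matrix and its block bounds\<close>
  have "x \<bullet> (?G *v y) = (?G *v x) \<bullet> y" for x y
    by (metis gram_matrix_inner inner_commute)
  then obtain V \<mu> where V: "pairwise orthogonal V" "\<And>v. v \<in> V \<Longrightarrow> norm v = 1"
    "span V = UNIV" "\<And>v. v \<in> V \<Longrightarrow> ?G *v v = \<mu> v *\<^sub>R v"
    using self_adjoint_orthonormal_eigenbasis[OF matrix_vector_mul_linear, of ?G] by blast
  have eigen_bounds: "block_energy \<beta> (1 + \<beta> - \<alpha> * \<mu> v) a b \<le> K * (a\<^sup>2 + b\<^sup>2)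
      \<and> a\<^sup>2 + b\<^sup>2 \<le> L * block_energy \<beta> (1 + \<beta> - \<alpha> * \<mu> v) a b" if "v \<in> V" for v a b
  proof -
    have "\<mu> v \<in> range lam"
      using eigenvalue_in_family[OF lam V(4)[OF that]] V(2)[OF that] by force
    then obtain j where "\<mu> v = lam j" by blast
    then show ?thesis
      using bounds(1)[of j a b] bounds(2)[of a b j] by (simp add: K_def L_def)
  qed
  interpret hbm_energy A p \<eta> \<alpha> \<beta> K L V \<mu>
  proof
    show "(norm (row j A))\<^sup>2 \<le> \<eta> * (frobenius_norm A)\<^sup>2 * pmf p j" for j
      using p_eta[of j] F by (simp add: F_def divide_le_eq mult_ac)
  qed (use V p_pos eta beta eigen_bounds in \<open>auto simp: K_def L_def\<close>)

  \<comment> \<open>Batch size and growth factor\<close>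
  define \<theta> where "\<theta> = ln kstar / kstar"
  have lnk: "ln kstar > 0" using kstar by simp
  \<comment> \<open>A condition number is at least 1; here the two block bounds are chained at the
    pair (1, 0).\<close>
  have KL: "1 \<le> K * L"
  proof -
    let ?h = "block_energy \<beta> (1 + \<beta> - \<alpha> * lam undefined) 1 0"
    have "1 \<le> L * ?h"
      using bounds(2)[of 1 0 undefined] by (simp add: L_def)
    also have "\<dots> \<le> L * K"
      using bounds(1)[of undefined 1 0] L_nonneg by (intro mult_left_mono) (auto simp: K_def)
    finally show ?thesis by (simp add: mult.commute)
  qed
  then have M_pos: "M > 0" using M by (cases "M = 0") auto
  \<comment> \<open>The first entry of the maximum in the batch size condition.\<close>
  define X where "X = F\<^sup>2 * N\<^sup>2 * \<alpha>\<^sup>2 * M\<^sup>2 * kstar / (\<beta> * ln kstar)"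
  have X: "X > 0"
    unfolding X_def using F N \<alpha> M_pos kstar lnk \<beta> by simp
  have B: "\<eta> * X \<le> real B"
  proof -
    have "ln 2 \<le> ln (2 * real CARD('d))" by simp
    \<comment> \<open>Hence the prefactor \<open>16 * exp 1 * ln (2 * real CARD('d))\<close> is at
      least 1.\<close>
    then have ln: "1 / 2 \<le> ln (2 * real CARD('d))" using ln2_ge_two_thirds by linarith
    have "1 \<le> 16 * exp 1 * (1 / 2 :: real)" using exp_ge_add_one_self[of "1::real"] by simp
    also have "\<dots> \<le> 16 * exp 1 * ln (2 * real CARD('d))"
      using ln by (intro mult_left_mono) auto
    finally have "1 * (\<eta> * X) \<le> 16 * exp 1 * ln (2 * real CARD('d)) * (\<eta> * X)"
      using eta X by (intro mult_right_mono) auto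
    also have "\<dots> = 16 * exp 1 * \<eta> * ln (2 * real CARD('d)) * X" by simp
    also have "\<dots> \<le> real B"
    proof (intro order_trans[OF mult_left_mono batch])
      have "0 \<le> ln (2 * real CARD('d))" using ln by linarith
      then show "0 \<le> 16 * exp 1 * \<eta> * ln (2 * real CARD('d))"
        using eta by (intro mult_nonneg_nonneg) auto
    qed (simp add: X_def F_def N_def M_def)
    finally show ?thesis by simp
  qed
  then have B_pos: "B > 0" using X eta by (cases "B = 0") (auto simp: mult_le_0_iff)
  have "K * L * \<alpha>\<^sup>2 * \<eta> * F\<^sup>2 * N\<^sup>2 = \<eta> * X * (\<beta> * \<theta>)"
    using \<beta> lnk kstar by (simp add: X_def M(2) \<theta>_def field_simps)
  also have "\<dots> \<le> real B * (\<beta> * \<theta>)"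
    using B \<beta> lnk kstar by (intro mult_right_mono) (auto simp: \<theta>_def)
  finally have "growth B \<le> \<beta> + \<beta> * \<theta>"
    using B_pos by (simp add: growth_def F_def N_def divide_le_eq mult_ac)
  also have "\<dots> \<le> \<beta> * exp \<theta>"
    using mult_left_mono[OF exp_ge_add_one_self[of \<theta>] beta] by (simp add: algebra_simps)
  \<comment> \<open>The square is introduced so that the later square root yields
    \<open>exp \<theta> ^ k\<close>, which is \<open>kstar powr (real k / kstar)\<close>.\<close>
  also have "\<dots> \<le> \<beta> * (exp \<theta>)\<^sup>2"
    using \<beta> lnk kstar by (intro mult_left_mono self_le_power) (auto simp: \<theta>_def)
  finally have "growth B ^ k \<le> (\<beta> * (exp \<theta>)\<^sup>2) ^ k"
    by (intro power_mono growth_nonneg)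
  also have "\<dots> = (r ^ k * exp \<theta> ^ k)\<^sup>2"
    by (simp add: r(2) power_mult_distrib power_mult[symmetric] mult.commute)
  also have "exp \<theta> ^ k = kstar powr (real k / kstar)"
    using kstar by (simp add: \<theta>_def powr_def exp_of_nat_mult[symmetric])
  finally have growth: "growth B ^ k \<le> (r ^ k * kstar powr (real k / kstar))\<^sup>2" .

  \<comment> \<open>Transfer to the random iterates\<close>
  let ?e = "x0 - xstar" and ?q = "replicate_pmf B p"
  let ?js = "rev [1..<Suc k]"
  interpret P: prob_space \<Omega> by (fact prob)
  have js: "distinct ?js" "set ?js \<subseteq> {1..}" "length ?js = k" by auto
  note batches = P.distr_map_indep_vars[OF S_indep js(1,2), of ?q]
  \<comment> \<open>The list \<open>?js\<close> runs from \<open>k\<close> down to 1; after these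
    \<open>k\<close> batches the second component of the state is the error of iterate
    \<open>k\<close>.\<close>
  have "P.expectation (\<lambda>\<omega>. norm (minibatch_hbm A b p B \<alpha> \<beta> x0 (\<lambda>i. S i \<omega>) k - xstar))
      = P.expectation (\<lambda>\<omega>. norm (snd (hbm_state A p B \<alpha> \<beta> ?e (map (\<lambda>i. S i \<omega>) ?js))))"
    unfolding hbm_state_eq consistent[symmetric] minibatch_hbm_shift by simp
  also have "\<dots> = measure_pmf.expectation (replicate_pmf k ?q)
      (\<lambda>ss. norm (snd (hbm_state A p B \<alpha> \<beta> ?e ss)))"
    using batches S_distr js(3)
    by (subst integral_distr[symmetric, OF batches(1)]) auto
  also have "\<dots> \<le> sqrt 2 * M * (kstar powr (real k / kstar)) * r ^ k * norm ?e"
  proof (rule power2_le_imp_le)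
    have "2 * (K * L) * growth B ^ k * (norm ?e)\<^sup>2
        \<le> 2 * (K * L) * (r ^ k * kstar powr (real k / kstar))\<^sup>2 * (norm ?e)\<^sup>2"
      using growth KL by (intro mult_right_mono mult_left_mono) auto
    also have "\<dots> = (sqrt 2 * M * (kstar powr (real k / kstar)) * r ^ k * norm ?e)\<^sup>2"
      by (simp add: M(2) power_mult_distrib)
    finally show "(measure_pmf.expectation (replicate_pmf k ?q)
        (\<lambda>ss. norm (snd (hbm_state A p B \<alpha> \<beta> ?e ss))))\<^sup>2
      \<le> (sqrt 2 * M * (kstar powr (real k / kstar)) * r ^ k * norm ?e)\<^sup>2"
      using expectation_norm_state[OF B_pos, of k ?e] by linarith
  qed (use M r in auto)
  also have "\<dots> \<le> sqrt 2 * M * max (real CARD('d)) (kstar powr (real k / kstar)) * r ^ k * norm ?e"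
    using M r by (intro mult_right_mono mult_left_mono) auto
  finally show "P.expectation
        (\<lambda>\<omega>. norm (minibatch_hbm A b p B \<alpha> \<beta> x0 (\<lambda>i. S i \<omega>) k - xstar))
      \<le> sqrt 2 * hbm_cond \<alpha> \<beta> lam * max (real CARD('d)) (kstar powr (real k / kstar))
        * sqrt \<beta> ^ k * norm (x0 - xstar)"
    unfolding M_def r_def .
qed

end
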